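(* Let $A,R,X$ be pairwise disjoint finite sets of propositional variables and let $f$ be a formula in $(A\uplus R,X)$-layered smooth decision-DNNF. Let $U(f)$ and $L(f)$ be the upper and lower bounds for $\mathrm{emajsat}_A(f)$ computed by the algorithm Relax. Then $$U(f)\le 2^{|R\cap V(f)|}\,L(f),$$ where $V(f)$ is the set of variables of $f$.
   Context: Decision-DNNF. A formula in decision-DNNF is a DAG built from the following nodes ($V(f)$ denotes the set of variables of $f$): (i) $\top$ and $\bot$, with $V(\top)=V(\bot)=\varnothing$; (ii) decomposable And nodes $\bigwedge_{i=1}^n f_i$ where the $f_i$ are in decision-DNNF and $V(f_i)\cap V(f_j)=\varnothing$ for $i\ne j$; (iii) decision nodes $\mathrm{ite}(v,g,h)$ ("if $v$ then $g$ else $h$") where $v$ is a variable, $g,h$ are in decision-DNNF, $v\notin V(g)$ and $v\notin V(h)$; $V(\mathrm{ite}(v,g,h))=\{v\}\cup V(g)\cup V(h)$. The formula is smooth if $V(g)=V(h)$ for every decision node $\mathrm{ite}(v,g,h)$. For disjoint sets $Y,Z$ of variables, it is $(Y,Z)$-layered if $V(f)\subseteq Y\uplus Z$ and, for every decision node $\mathrm{ite}(v,g,h)$, $v\in Z$ implies $V(g)\subseteq Z$ (for smooth formulas, hence also $V(h)\subseteq Z$). Model counts. With $\mathbb B=\{\top,\bot\}$ and $a\in\mathbb B^A$, $f|_a$ is $f$ with each variable $v\in A$ replaced by $a(v)$; $\sharp(f|_a)$ is its number of models, counted as valuations of $V(f)\setminus A$. $\mathrm{emajsat}_A(f)=\max_{a\in\mathbb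 B^A}\sharp(f|_a)$. Upper bound $U$: $U(\top)=1$, $U(\bot)=0$; $U(\mathrm{ite}(v,g,h))=U(g)+U(h)$ if $v\in X$ or $v\in R$; $U(\mathrm{ite}(v,g,h))=\max(U(g),U(h))$ if $v\in A$; $U(\bigwedge_{i=1}^n g_i)=\prod_{i=1}^n U(g_i)$. Witness. For a set $B$ of variables and $f$ in $(B,X)$-layered smooth decision-DNNF, define $C(f)\in\mathbb N$ and $w_B(f)\in\mathbb B^B$ inductively, where $a_\bot\in\mathbb B^B$ maps every variable to $\bot$ and $a[v:=b]$ is $a$ modified to map $v$ to $b$: $C(\top)=1$, $C(\bot)=0$, $w_B(\top)=w_B(\bot)=a_\bot$; for $v\notin B$, $C(\mathrm{ite}(v,g,h))=C(g)+C(h)$ and $w_B(\mathrm{ite}(v,g,h))=a_\bot$; for $v\in B$, if $C(g)<C(h)$ then $C(\mathrm{ite}(v,g,h))=C(h)$ and $w_B(\mathrm{ite}(v,g,h))=w_B(h)[v:=\bot]$, otherwise $C(\mathrm{ite}(v,g,h))=C(g)$ and $w_B(\mathrm{ite}(v,g,h))=w_B(g)[v:=\top]$; $C(\bigwedge_i g_i)=\prod_i C(g_i)$ and $w_B(\bigwedge_i g_i)$ is the combination of the $w_B(g_i)$: it agrees with $w_B(g_i)$ on $B\cap V(g_i)$ for each $i$ and maps all other variables of $B$ to $\bot$. Lower bound $L$: let $w\in\mathbb B^A$ be the restriction of $w_{A\cup R}(f)$ to $A$; then $L(f)=\sharp(f|_w)$ (models counted over $V(f)\setminus A$). *)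

theory Defs
  imports Main "HOL-Library.FuncSet"
begin

text \<open>
  Formulas are the tree unfoldings of the DAGs: sharing of nodes only affects the size of a
  representation, and every notion below is defined by recursion on the formula below a node.
  The generated set function \<open>vars\<close> is $V$, with $V(\mathrm{ite}(v,g,h)) = \{v\} \cup V(g) \cup V(h)$;
  the generated map function is substitution of the decision variables.
\<close>

datatype (vars: 'v) formula =
    Top
  | Bot
  | And "'v formula list"
  | Ite 'v "'v formula" "'v formula"
  for map: subst

fun decision_dnnf :: "'v formula \<Rightarrow> bool" where
  "decision_dnnf Top \<longleftrightarrow> True"
| "decision_dnnf Bot \<longleftrightarrow> True"
| "decision_dnnf (And fs) \<longleftrightarrow>
     (\<forall>f\<in>set fs. decision_dnnf f) \<and>
     (\<forall>i<length fs. \<forall>j<length fs. i \<noteq> j \<longrightarrow> vars (fs ! i) \<inter> vars (fs ! j) = {})"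
| "decision_dnnf (Ite v g h) \<longleftrightarrow>
     decision_dnnf g \<and> decision_dnnf h \<and> v \<notin> vars g \<and> v \<notin> vars h"

fun nodes :: "'v formula \<Rightarrow> 'v formula set" where
  "nodes Top = {Top}"
| "nodes Bot = {Bot}"
| "nodes (And fs) = {And fs} \<union> (\<Union>f\<in>set fs. nodes f)"
| "nodes (Ite v g h) = {Ite v g h} \<union> nodes g \<union> nodes h"

definition smooth :: "'v formula \<Rightarrow> bool" where
  "smooth f \<longleftrightarrow> (\<forall>v g h. Ite v g h \<in> nodes f \<longrightarrow> vars g = vars h)"

definition layered :: "'v set \<Rightarrow> 'v set \<Rightarrow> 'v formula \<Rightarrow> bool" where
  "layered Y Z f \<longleftrightarrow> vars f \<subseteq> Y \<union> Z \<and>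
     (\<forall>v g h. Ite v g h \<in> nodes f \<longrightarrow> v \<in> Z \<longrightarrow> vars g \<subseteq> Z)"

fun eval :: "('v \<Rightarrow> bool) \<Rightarrow> 'v formula \<Rightarrow> bool" where
  "eval m Top \<longleftrightarrow> True"
| "eval m Bot \<longleftrightarrow> False"
| "eval m (And fs) \<longleftrightarrow> (\<forall>f\<in>set fs. eval m f)"
| "eval m (Ite v g h) \<longleftrightarrow> (if m v then eval m g else eval m h)"

text \<open>
  In $f|_a$ a decision is made either on a remaining variable \<open>Inl v\<close> or on a constant
  \<open>Inr b\<close>. A valuation in $\mathbb{B}^S$ is an element of the extensional function space
  \<open>S \<rightarrow>\<^sub>E UNIV\<close>, so that valuations are determined by their values on $S$ and can be counted.
\<close>

definition cond :: "'v set \<Rightarrow> ('v \<Rightarrow> bool) \<Rightarrow> 'v formula \<Rightarrow> ('v + bool) formula" where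
  "cond A a f = subst (\<lambda>v. if v \<in> A then Inr (a v) else Inl v) f"

definition count_cond :: "'v set \<Rightarrow> ('v \<Rightarrow> bool) \<Rightarrow> 'v formula \<Rightarrow> nat" where
  "count_cond A a f =
     card {m \<in> (vars f - A) \<rightarrow>\<^sub>E UNIV. eval (case_sum m id) (cond A a f)}"

text \<open>Decision variables outside $A$ are those in $X$ or $R$.\<close>

fun upper :: "'v set \<Rightarrow> 'v formula \<Rightarrow> nat" where
  "upper A Top = 1"
| "upper A Bot = 0"
| "upper A (And fs) = prod_list (map (upper A) fs)"
| "upper A (Ite v g h) =
     (if v \<in> A then max (upper A g) (upper A h) else upper A g + upper A h)"

fun C :: "'v set \<Rightarrow> 'v formula \<Rightarrow> nat" where
  "C B Top = 1"
| "C B Bot = 0"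
| "C B (And fs) = prod_list (map (C B) fs)"
| "C B (Ite v g h) =
     (if v \<notin> B then C B g + C B h
      else if C B g < C B h then C B h else C B g)"

text \<open>
  At a decomposable And node at most one conjunct contains a given variable, so the
  existential below selects the value given by that conjunct, and is false when there is none
  (see \<open>witness_And\<close> and \<open>witness_And_other\<close>).
\<close>

fun witness :: "'v set \<Rightarrow> 'v formula \<Rightarrow> 'v \<Rightarrow> bool" where
  "witness B Top = (\<lambda>u\<in>B. False)"
| "witness B Bot = (\<lambda>u\<in>B. False)"
| "witness B (And fs) = (\<lambda>u\<in>B. \<exists>f\<in>set fs. u \<in> vars f \<and> witness B f u)"
| "witness B (Ite v g h) =
     (if v \<notin> B then (\<lambda>u\<in>B. False)
      else if C B g < C B h then (witness B h)(v := False)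
      else (witness B g)(v := True))"

lemma witness_in_PiE: "witness B f \<in> B \<rightarrow>\<^sub>E UNIV"
proof -
  have "witness B f u = undefined" if "u \<notin> B" for u
    using that by (induction f) auto
  then show ?thesis by (intro PiE_I UNIV_I)
qed

lemma witness_And:
  assumes "decision_dnnf (And fs)" and "f \<in> set fs" and "u \<in> B \<inter> vars f"
  shows "witness B (And fs) u = witness B f u"
proof -
  have "g = f" if g: "g \<in> set fs" "u \<in> vars g" for g
  proof -
    obtain i where i: "i < length fs" "fs ! i = f"
      using assms(2) unfolding in_set_conv_nth by blast
    obtain j where j: "j < length fs" "fs ! j = g"
      using g(1) unfolding in_set_conv_nth by blast
    have "i = j"
    proof (rule ccontr)
      assume "i \<noteq> j"
      with assms(1) i j have "vars f \<inter> vars g = {}"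
        unfolding decision_dnnf.simps by blast
      with assms(3) g(2) show False by blast
    qed
    with i j show ?thesis by simp
  qed
  then have "(\<exists>g\<in>set fs. u \<in> vars g \<and> witness B g u) \<longleftrightarrow> witness B f u"
    using assms(2,3) by blast
  with assms(3) show ?thesis by simp
qed

lemma witness_And_other:
  assumes "u \<in> B" and "\<And>f. f \<in> set fs \<Longrightarrow> u \<notin> vars f"
  shows "\<not> witness B (And fs) u"
  using assms by auto

definition lower :: "'v set \<Rightarrow> 'v set \<Rightarrow> 'v formula \<Rightarrow> nat" where
  "lower A R f = count_cond A (restrict (witness (A \<union> R) f) A) f"

end

theory Submission
  imports Defs
begin

text \<open>
  With $B = A \uplus R$, the quantity $C(f)$ separates the two bounds. A decision on a variable of
  $R$ replaces a maximum by a sum, which at most doubles the value, and below an And node each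
  variable of $R$ occurs in only one factor; hence $U(f) \le 2^{|R \cap V(f)|}\, C(f)$. On the other
  hand $C(f) \le L(f)$: the chosen branch of a decision on $R$ contributes its models, and
  below a decision on $X$ there are no variables of $B$, so the choice of witness is immaterial.
\<close>

section \<open>Evaluation, and how the structural conditions pass to subformulas\<close>

lemma finite_vars: "finite (vars f)"
  by (induction f) auto

lemma eval_cong: "(\<And>v. v \<in> vars f \<Longrightarrow> m v = m' v) \<Longrightarrow> eval m f = eval m' f"
proof (induction f)
  case (And fs)
  then have "eval m f = eval m' f" if "f \<in> set fs" for f
    using that by auto
  then show ?case by simp
qed auto

lemma eval_subst: "eval m (subst s f) = eval (m \<circ> s) f"
  by (induction f) auto

text \<open>Turns pairwise disjointness of indexed conjuncts into the head-against-tail form that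
  inductions over the list of conjuncts use.\<close>

lemma decision_dnnf_And_Cons:
  assumes "decision_dnnf (And (f # fs))"
  shows "decision_dnnf f" and "decision_dnnf (And fs)" and "vars f \<inter> vars (And fs) = {}"
proof -
  have disj: "vars ((f # fs) ! i) \<inter> vars ((f # fs) ! j) = {}"
    if "i < Suc (length fs)" "j < Suc (length fs)" "i \<noteq> j" for i j
    using assms that by auto
  show "decision_dnnf f" using assms by simp
  have "vars (fs ! i) \<inter> vars (fs ! j) = {}" if "i < length fs" "j < length fs" "i \<noteq> j" for i j
    using disj[of "Suc i" "Suc j"] that by simp
  then show "decision_dnnf (And fs)" using assms by simp
  have "vars f \<inter> vars (fs ! j) = {}" if "j < length fs" for j
    using disj[of 0 "Suc j"] that by simp
  then show "vars f \<inter> vars (And fs) = {}"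
    by (fastforce simp: in_set_conv_nth)
qed

lemma smooth_And: "smooth (And fs) \<Longrightarrow> f \<in> set fs \<Longrightarrow> smooth f"
  unfolding smooth_def by fastforce

lemma smooth_Ite:
  assumes "smooth (Ite v g h)"
  shows "smooth g" and "smooth h" and "vars g = vars h"
  using assms unfolding smooth_def by auto

lemma layered_And: "layered Y Z (And fs) \<Longrightarrow> f \<in> set fs \<Longrightarrow> layered Y Z f"
  unfolding layered_def by fastforce

lemma layered_Ite:
  assumes "layered Y Z (Ite v g h)"
  shows "layered Y Z g" and "layered Y Z h" and "v \<in> Y \<union> Z"
    and "v \<in> Z \<Longrightarrow> vars g \<subseteq> Z"
  using assms unfolding layered_def by auto

section \<open>Model counts at And and decision nodes\<close>

lemma count_cond_eq:
  "count_cond A a f =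
     card {m \<in> (vars f - A) \<rightarrow>\<^sub>E UNIV. eval (\<lambda>v. if v \<in> A then a v else m v) f}"
proof -
  \<comment> \<open>Evaluating $f|_a$ is evaluating \<open>f\<close> under the merge of
    \<open>a\<close> on \<open>A\<close> with \<open>m\<close> elsewhere. All later counting uses
    this form, free of the sum type.\<close>
  have "case_sum m id \<circ> (\<lambda>v. if v \<in> A then Inr (a v) else Inl v) = (\<lambda>v. if v \<in> A then a v else m v)"
    for m :: "'a \<Rightarrow> bool" by auto
  then show ?thesis unfolding count_cond_def cond_def eval_subst by simp
qed

text \<open>This allows the witness of a node to be exchanged for that of a child wherever the two
  agree on the relevant variables.\<close>

lemma count_cond_cong:
  assumes "\<And>v. v \<in> A \<inter> vars f \<Longrightarrow> a v = b v"
  shows "count_cond A a f = count_cond A b f"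
proof -
  have "eval (\<lambda>v. if v \<in> A then a v else m v) f = eval (\<lambda>v. if v \<in> A then b v else m v) f" for m
    using assms by (intro eval_cong) auto
  then show ?thesis unfolding count_cond_eq by simp
qed

lemma count_cond_And_Nil: "count_cond A a (And []) = 1"
  unfolding count_cond_eq by simp

text \<open>By decomposability, a model of the conjunction is an independent pair of models, one
  over the free variables of \<open>f\<close> and one over those of \<open>fs\<close>.\<close>

lemma count_cond_And_Cons:
  assumes "vars f \<inter> vars (And fs) = {}"
  shows "count_cond A a (And (f # fs)) = count_cond A a f * count_cond A a (And fs)"
proof -
  define S T where "S = vars f - A" and "T = vars (And fs) - A"
  define e where "e m v = (if v \<in> A then a v else m v)" for m v
  have disj: "S \<inter> T = {}" and un: "vars (And (f # fs)) - A = S \<union> T"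
    using assms unfolding S_def T_def by auto
  let ?M = "{m \<in> (S \<union> T) \<rightarrow>\<^sub>E UNIV. eval (e m) (And (f # fs))}"
  let ?M1 = "{m \<in> S \<rightarrow>\<^sub>E UNIV. eval (e m) f}"
  let ?M2 = "{m \<in> T \<rightarrow>\<^sub>E UNIV. eval (e m) (And fs)}"
  have e1: "eval (e m) f = eval (e m') f" if "\<And>v. v \<in> S \<Longrightarrow> m v = m' v" for m m'
    by (intro eval_cong) (use that in \<open>simp add: e_def S_def\<close>)
  have e2: "eval (e m) (And fs) = eval (e m') (And fs)" if "\<And>v. v \<in> T \<Longrightarrow> m v = m' v" for m m'
    by (intro eval_cong) (use that in \<open>simp add: e_def T_def del: formula.set\<close>)
  \<comment> \<open>Outside \<open>S \<union> T\<close> this takes the value of \<open>m2\<close>,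
    which is \<open>undefined\<close> there, so the joined function is extensional again.\<close>
  let ?join = "\<lambda>(m1, m2) v. if v \<in> S then m1 v else m2 v"
  have "bij_betw (\<lambda>m. (restrict m S, restrict m T)) ?M (?M1 \<times> ?M2)"
  proof (rule bij_betw_byWitness[where f' = ?join])
    show "\<forall>m\<in>?M. ?join (restrict m S, restrict m T) = m"
      by (auto simp: fun_eq_iff PiE_iff extensional_def)
    show "\<forall>p\<in>?M1 \<times> ?M2. (restrict (?join p) S, restrict (?join p) T) = p"
      using disj by (auto simp: fun_eq_iff PiE_iff extensional_def restrict_def)
    show "(\<lambda>m. (restrict m S, restrict m T)) ` ?M \<subseteq> ?M1 \<times> ?M2"
    proof (intro image_subsetI)
      fix m assume m: "m \<in> ?M"
      have "eval (e (restrict m S)) f = eval (e m) f" by (rule e1) simp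
      moreover have "eval (e (restrict m T)) (And fs) = eval (e m) (And fs)" by (rule e2) simp
      ultimately show "(restrict m S, restrict m T) \<in> ?M1 \<times> ?M2" using m by auto
    qed
    show "?join ` (?M1 \<times> ?M2) \<subseteq> ?M"
    proof (intro image_subsetI)
      fix p assume "p \<in> ?M1 \<times> ?M2"
      then obtain m1 m2 where p: "p = (m1, m2)" and m1: "m1 \<in> ?M1" and m2: "m2 \<in> ?M2" by auto
      have "eval (e (?join p)) f = eval (e m1) f" by (rule e1) (simp add: p)
      moreover have "eval (e (?join p)) (And fs) = eval (e m2) (And fs)"
        using disj by (intro e2) (auto simp: p)
      moreover have "?join p \<in> (S \<union> T) \<rightarrow>\<^sub>E UNIV"
        using m1 m2 by (auto simp: p PiE_iff extensional_def)
      ultimately show "?join p \<in> ?M" using m1 m2 by simp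
    qed
  qed
  then have "card ?M = card ?M1 * card ?M2"
    by (simp add: bij_betw_same_card card_cartesian_product)
  then show ?thesis
    unfolding count_cond_eq un unfolding S_def T_def e_def .
qed

text \<open>Conditioning fixes the decision, and smoothness ensures that the node and the selected
  branch are counted over the same free variables.\<close>

lemma count_cond_Ite_mem:
  assumes "v \<in> A" and "vars g = vars h"
  shows "count_cond A a (Ite v g h) = count_cond A a (if a v then g else h)"
proof -
  have "vars (Ite v g h) - A = vars (if a v then g else h) - A"
    using assms by auto
  then show ?thesis unfolding count_cond_eq using assms(1) by (simp del: formula.set)
qed

text \<open>Prescribing the value at a new variable adds no freedom when \<open>P\<close> depends on
  \<open>S\<close> only: restriction to \<open>S\<close> is inverted by the update at
  \<open>v\<close>.\<close>

lemma card_extend: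
  assumes "v \<notin> S" and "\<And>m m'. (\<And>u. u \<in> S \<Longrightarrow> m u = m' u) \<Longrightarrow> P m = P m'"
  shows "card {m \<in> insert v S \<rightarrow>\<^sub>E UNIV. m v = b \<and> P m} = card {m \<in> S \<rightarrow>\<^sub>E UNIV. P m}"
    (is "card ?M = card ?N")
proof (rule bij_betw_same_card, rule bij_betw_byWitness[where f' = "\<lambda>m. m(v := b)"])
  show "\<forall>m\<in>?M. (restrict m S)(v := b) = m"
    by (auto simp: fun_eq_iff PiE_iff extensional_def)
  show "\<forall>m\<in>?N. restrict (m(v := b)) S = m"
    using assms(1) by (auto simp: fun_eq_iff PiE_iff extensional_def restrict_def)
  have "P (restrict m S) = P m" for m by (rule assms(2)) simp
  then show "(\<lambda>m. restrict m S) ` ?M \<subseteq> ?N" by auto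
  have "P (m(v := b)) = P m" for m by (rule assms(2)) (use assms(1) in auto)
  then show "(\<lambda>m. m(v := b)) ` ?N \<subseteq> ?M" by (auto simp: PiE_iff extensional_def)
qed

lemma count_cond_Ite_not_mem:
  assumes v: "v \<notin> A" "v \<notin> vars g" and eq: "vars g = vars h"
  shows "count_cond A a (Ite v g h) = count_cond A a g + count_cond A a h"
proof -
  define S where "S = vars g - A"
  define e where "e m v = (if v \<in> A then a v else m v)" for m v
  have un: "vars (Ite v g h) - A = insert v S" and S: "vars h - A = S"
    using v eq unfolding S_def by auto
  have "finite (insert v S)" by (simp add: S_def finite_vars)
  then have fin: "finite (insert v S \<rightarrow>\<^sub>E (UNIV :: bool set))"
    by (intro finite_PiE) auto
  let ?M = "\<lambda>b f. {m \<in> insert v S \<rightarrow>\<^sub>E UNIV. m v = b \<and> eval (e m) f}"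
  have ext: "card (?M b f) = card {m \<in> S \<rightarrow>\<^sub>E UNIV. eval (e m) f}" if "vars f = vars g" for b f
  proof (rule card_extend)
    show "v \<notin> S" using v by (simp add: S_def)
    show "eval (e m) f = eval (e m') f" if "\<And>u. u \<in> S \<Longrightarrow> m u = m' u" for m m'
      using that \<open>vars f = vars g\<close> by (intro eval_cong) (auto simp: e_def S_def)
  qed
  \<comment> \<open>Models split by their value at \<open>v\<close>. Smoothness makes
    \<open>S\<close> the set of remaining variables for both branches, so no correcting factor
    appears.\<close>
  have "{m \<in> insert v S \<rightarrow>\<^sub>E UNIV. eval (e m) (Ite v g h)} = ?M True g \<union> ?M False h"
    using v by (auto simp: e_def)
  then have "card {m \<in> insert v S \<rightarrow>\<^sub>E UNIV. eval (e m) (Ite v g h)}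
      = card (?M True g) + card (?M False h)"
    using fin by (simp only:) (rule card_Un_disjoint, auto)
  also have "\<dots> = card {m \<in> S \<rightarrow>\<^sub>E UNIV. eval (e m) g} + card {m \<in> S \<rightarrow>\<^sub>E UNIV. eval (e m) h}"
    by (simp only: ext[OF refl] ext[OF eq[symmetric]])
  finally show ?thesis
    unfolding count_cond_eq un S unfolding S_def e_def .
qed

section \<open>Comparing \<open>upper\<close> with \<open>C\<close>\<close>

lemma upper_le_C:
  assumes "finite R" and "decision_dnnf f" and "smooth f" and "vars f \<subseteq> A \<union> R \<union> X"
    and "A \<inter> R = {}"
  shows "upper A f \<le> 2 ^ card (R \<inter> vars f) * C (A \<union> R) f"
  using assms(2-4)
proof (induction f)
  case (And fs)
  have "upper A f \<le> 2 ^ card (R \<inter> vars f) * C (A \<union> R) f" if "f \<in> set fs" for f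
    using And.prems that by (intro And.IH) (auto intro: smooth_And)
  \<comment> \<open>The inner list induction carries the bounds for the individual conjuncts along;
    decomposability makes the exponents add up as the factors multiply.\<close>
  with And.prems(1) show ?case
  proof (induction fs)
    case (Cons f fs)
    note dnnf = decision_dnnf_And_Cons[OF Cons.prems(1)]
    have "card (R \<inter> vars (And (f # fs))) = card ((R \<inter> vars f) \<union> (R \<inter> vars (And fs)))"
      by (rule arg_cong[of _ _ card]) auto
    also have "\<dots> = card (R \<inter> vars f) + card (R \<inter> vars (And fs))"
      using dnnf(3) assms(1) by (intro card_Un_disjoint) auto
    finally have card: "card (R \<inter> vars (And (f # fs))) = \<dots>" .
    have "upper A f \<le> 2 ^ card (R \<inter> vars f) * C (A \<union> R) f"
      using Cons.prems(2) by simp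
    moreover have "upper A (And fs) \<le> 2 ^ card (R \<inter> vars (And fs)) * C (A \<union> R) (And fs)"
      using Cons.prems(2) by (intro Cons.IH dnnf) simp
    ultimately have "upper A f * upper A (And fs) \<le>
        (2 ^ card (R \<inter> vars f) * C (A \<union> R) f) *
        (2 ^ card (R \<inter> vars (And fs)) * C (A \<union> R) (And fs))"
      by (rule mult_le_mono)
    then show ?case unfolding card by (simp add: power_add ac_simps)
  qed simp
next
  case (Ite v g h)
  note eq = smooth_Ite(3)[OF Ite.prems(2)]
  define k where "k = card (R \<inter> vars g)"
  have g: "upper A g \<le> 2 ^ k * C (A \<union> R) g"
    using Ite.prems unfolding k_def by (intro Ite.IH) (auto dest: smooth_Ite)
  have h: "upper A h \<le> 2 ^ k * C (A \<union> R) h"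
    using Ite.prems unfolding k_def eq by (intro Ite.IH) (auto dest: smooth_Ite)
  have max: "upper A g \<le> 2 ^ k * max (C (A \<union> R) g) (C (A \<union> R) h)"
    "upper A h \<le> 2 ^ k * max (C (A \<union> R) g) (C (A \<union> R) h)"
    using g h by (meson le_trans max.cobounded1 max.cobounded2 mult_le_mono2)+
  have C: "C (A \<union> R) (Ite v g h) = (if v \<in> A \<union> R then max (C (A \<union> R) g) (C (A \<union> R) h)
      else C (A \<union> R) g + C (A \<union> R) h)"
    by auto
  show ?case
  proof (cases "v \<in> R")
    case True
    \<comment> \<open>As \<open>v\<close> does not occur in \<open>g\<close>, the exponent grows by
      one; this pays for bounding a sum by twice the maximum.\<close>
    then have "R \<inter> vars (Ite v g h) = insert v (R \<inter> vars g)" using eq by auto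
    then have "card (R \<inter> vars (Ite v g h)) = Suc k"
      using Ite.prems(1) assms(1) by (simp add: k_def)
    moreover have "v \<notin> A" using True assms(5) by auto
    ultimately show ?thesis using True max unfolding C by simp
  next
    case False
    \<comment> \<open>The exponent is unchanged, and both quantities now apply the same operation: a
      maximum if \<open>v \<in> A\<close>, a sum otherwise.\<close>
    then have "R \<inter> vars (Ite v g h) = R \<inter> vars g" using eq by auto
    then have "card (R \<inter> vars (Ite v g h)) = k" by (simp add: k_def)
    then show ?thesis using False max g h unfolding C by (simp add: distrib_left)
  qed
qed auto

section \<open>Comparing \<open>C\<close> with the count at the witness\<close>

lemma C_le_count_cond:
  assumes "A \<subseteq> B" and "B \<inter> X = {}"
    and "decision_dnnf f" and "smooth f" and "layered B X f"
  shows "C B f \<le> count_cond A (witness B f) f"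
  using assms(3-5)
proof (induction f)
  case Top
  then show ?case unfolding count_cond_eq by simp
next
  case (And fs)
  define w where "w = witness B (And fs)"
  have "C B f \<le> count_cond A w f" if f: "f \<in> set fs" for f
  proof -
    have "C B f \<le> count_cond A (witness B f) f"
      using And.prems f by (intro And.IH) (auto intro: smooth_And layered_And)
    also have "\<dots> = count_cond A w f"
      unfolding w_def using assms(1)
      by (intro count_cond_cong witness_And[OF And.prems(1) f, symmetric]) auto
    finally show ?thesis .
  qed
  with And.prems(1) have "C B (And fs) \<le> count_cond A w (And fs)"
  proof (induction fs)
    case (Cons f fs)
    note dnnf = decision_dnnf_And_Cons[OF Cons.prems(1)]
    have "C B f * C B (And fs) \<le> count_cond A w f * count_cond A w (And fs)"
      using Cons.prems(2) by (intro mult_le_mono Cons.IH dnnf) auto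
    then show ?case by (simp add: count_cond_And_Cons[OF dnnf(3)])
  qed (simp add: count_cond_And_Nil)
  then show ?case unfolding w_def .
next
  case (Ite v g h)
  note eq = smooth_Ite(3)[OF Ite.prems(2)]
  define w where "w = witness B (Ite v g h)"
  have v: "v \<notin> vars g" "v \<notin> vars h" using Ite.prems(1) by auto
  have g: "C B g \<le> count_cond A (witness B g) g"
    using Ite.prems by (intro Ite.IH) (auto dest: smooth_Ite layered_Ite)
  have h: "C B h \<le> count_cond A (witness B h) h"
    using Ite.prems by (intro Ite.IH) (auto dest: smooth_Ite layered_Ite)
  have "C B (Ite v g h) \<le> count_cond A w (Ite v g h)"
  proof (cases "v \<in> B")
    case False
    then have "v \<in> X" using layered_Ite(3)[OF Ite.prems(3)] by auto
    then have "vars g \<subseteq> X" using layered_Ite(4)[OF Ite.prems(3)] by auto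
    \<comment> \<open>Layering leaves no variable of \<open>A\<close> below this node, so the
      constant witness chosen here gives the same counts as those of the branches.\<close>
    then have disj: "A \<inter> vars g = {}" "A \<inter> vars h = {}" using assms(1,2) eq by auto
    have "count_cond A (witness B g) g = count_cond A w g"
      "count_cond A (witness B h) h = count_cond A w h"
      using disj by (intro count_cond_cong; blast)+
    moreover have "v \<notin> A" using False assms(1) by auto
    ultimately show ?thesis
      using g h False v eq by (simp add: count_cond_Ite_not_mem)
  next
    case True
    \<comment> \<open>The branch that the witness follows; \<open>w\<close> differs from the witness
      of \<open>c\<close> only at \<open>v\<close>, which does not occur in
      \<open>c\<close>.\<close>
    define c where "c = (if C B g < C B h then h else g)"
    have C: "C B (Ite v g h) = C B c" and w: "w = (witness B c)(v := \<not> C B g < C B h)"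
      using True by (auto simp: c_def w_def)
    have "C B c \<le> count_cond A (witness B c) c"
      using g h by (simp add: c_def)
    also have "\<dots> = count_cond A w c"
      using v by (intro count_cond_cong) (auto simp: w c_def)
    also have "\<dots> \<le> count_cond A w (Ite v g h)"
    \<comment> \<open>For \<open>v \<in> A\<close> the value of \<open>w\<close> at \<open>v\<close>
      selects exactly \<open>c\<close>, giving equality. Otherwise \<open>v\<close> is counted over,
      and the models of the other branch only add to the total.\<close>
    proof (cases "v \<in> A")
      case True
      then show ?thesis by (simp add: count_cond_Ite_mem eq) (simp add: w c_def)
    next
      case False
      then show ?thesis using v eq by (simp add: count_cond_Ite_not_mem c_def)
    qed
    finally show ?thesis unfolding C .
  qed
  then show ?case unfolding w_def .
qed simp

theorem theorem7p13:
  fixes A R X :: "'v set" and f :: "'v formula"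
  assumes "finite A" and "finite R" and "finite X"
    and "A \<inter> R = {}" and "A \<inter> X = {}" and "R \<inter> X = {}"
    and "decision_dnnf f" and "smooth f" and "layered (A \<union> R) X f"
  shows "upper A f \<le> 2 ^ card (R \<inter> vars f) * lower A R f"
proof -
  have "upper A f \<le> 2 ^ card (R \<inter> vars f) * C (A \<union> R) f"
    using assms by (intro upper_le_C[where X = X]) (auto simp: layered_def)
  also have "C (A \<union> R) f \<le> count_cond A (witness (A \<union> R) f) f"
    using assms by (intro C_le_count_cond[where X = X]) auto
  \<comment> \<open>Values of the witness on \<open>R\<close> do not affect the count, so
    restricting it to \<open>A\<close> changes nothing.\<close>
  also have "\<dots> = lower A R f"
    unfolding lower_def by (rule count_cond_cong) simp
  finally show ?thesis by simp
qed

end
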